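(* Let $\mathcal{X}=(x_n)_{n=1}^\infty$ be a basis of a quasi-Banach space $X$. The following are equivalent: (i) $\mathcal{X}$ is bounded-oscillation unconditional. (ii) $\mathcal{X}$ is $(1,1)$-bounded-oscillation unconditional. (iii) $\mathcal{X}$ is truncation quasi-greedy.
   Context: $\mathbb{N}$ is the set of positive integers; the scalar field $\mathbb{F}$ is $\mathbb{R}$ or $\mathbb{C}$. A basis of a quasi-Banach space $X$ over $\mathbb{F}$ is a norm-bounded sequence $(x_n)_{n=1}^\infty$ in $X$ whose linear span is dense in $X$ and for which there is a (unique) norm-bounded sequence $(x_n^* )_{n=1}^\infty$ in $X^*$ with $x_n^*(x_k)=\delta_{n,k}$ for all $n,k$. For a finite set $A\subset\mathbb{N}$, $S_A(f)=\sum_{n\in A}x_n^*(f)x_n$. For a nonempty finite $A\subset\mathbb{N}$ and $f\in X$, the oscillation is $\mathrm{osc}(f,A)=\dfrac{\max_{n\in A}|x_n^*(f)|}{\min_{n\in A}|x_n^*(f)|}$, with $0/0=1$ and $a/0=\infty$ for $a>0$. Given $1\le d\le D<\infty$, the basis is $(D,d)$-bounded-oscillation unconditional if there is a constant $C$ such that $\|S_A(f)\|\le C\|f\|$ whenever $f\in X$ and $A$ is a nonempty finite subset of $\mathbb{N}$ such that $\mathrm{osc}(f,A)\le D$ and there are $n\in\mathbb{N}$ and a partition $(A_j)_{j=1}^n$ of $A$ into nonempty subsets with $\mathrm{osc}(f,A_j)\le d$ for $1\le j\le n$, $n\le\min(A_1)$, and $\max(A_j)<\min(A_{j+1})$ for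 $1\le j\le n-1$. The basis is bounded-oscillation unconditional if it is $(D,d)$-bounded-oscillation unconditional for every $1\le d\le D<\infty$. A finite set $A\subset\mathbb{N}$ is a greedy set of $f$ if $|x_n^*(f)|\ge|x_k^*(f)|$ for all $n\in A$, $k\in\mathbb{N}\setminus A$. Let $\mathrm{sign}(\lambda)=\lambda/|\lambda|$ for $\lambda\ne0$ and $\mathrm{sign}(0)=1$. The basis is truncation quasi-greedy if there is a constant $C$ such that $\min_{n\in A}|x_n^*(f)|\,\bigl\|\sum_{n\in A}\mathrm{sign}(x_n^*(f))\,x_n\bigr\|\le C\|f\|$ for all $f\in X$ and all nonempty greedy sets $A$ of $f$. *)

theory Defs
  imports Complex_Main "HOL-Library.Extended_Real" "HOL-Library.Disjoint_Sets"
begin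

text \<open>
  Sequences \<open>x :: nat \<Rightarrow> 'a\<close> are indexed by the positive integers: the value at index \<open>0\<close> is
  never used, and all index sets are subsets of \<open>{1..}\<close>.
\<close>

text \<open>Unlike \<^const>\<open>sgn\<close>, the sign of \<open>0\<close> is \<open>1\<close>.\<close>

definition sign :: "'f::real_normed_field \<Rightarrow> 'f" where
  "sign c = (if c = 0 then 1 else c / of_real (norm c))"

locale quasi_normed_space =
  vector_space scale
  for scale :: "'f::real_normed_field \<Rightarrow> 'a::ab_group_add \<Rightarrow> 'a" +
  fixes qnorm :: "'a \<Rightarrow> real"
  assumes qnorm_nonneg: "0 \<le> qnorm f"
    and qnorm_eq_0_iff: "qnorm f = 0 \<longleftrightarrow> f = 0"
    and qnorm_scale: "qnorm (scale c f) = norm c * qnorm f"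
    and qnorm_add: "\<exists>\<kappa>\<ge>1. \<forall>f g. qnorm (f + g) \<le> \<kappa> * (qnorm f + qnorm g)"
begin

definition qCauchy :: "(nat \<Rightarrow> 'a) \<Rightarrow> bool" where
  "qCauchy u \<longleftrightarrow> (\<forall>e>0. \<exists>N. \<forall>m\<ge>N. \<forall>n\<ge>N. qnorm (u m - u n) < e)"

definition qconvergent :: "(nat \<Rightarrow> 'a) \<Rightarrow> bool" where
  "qconvergent u \<longleftrightarrow> (\<exists>f. (\<lambda>n. qnorm (u n - f)) \<longlonglongrightarrow> 0)"

definition qdense :: "'a set \<Rightarrow> bool" where
  "qdense S \<longleftrightarrow> (\<forall>f. \<forall>e>0. \<exists>g\<in>S. qnorm (f - g) < e)"

definition dual :: "('a \<Rightarrow> 'f) set" where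
  "dual = {\<phi>. Vector_Spaces.linear scale (*) \<phi> \<and> (\<exists>C. \<forall>f. norm (\<phi> f) \<le> C * qnorm f)}"

definition dual_norm :: "('a \<Rightarrow> 'f) \<Rightarrow> real" where
  "dual_norm \<phi> = (SUP f\<in>{f. qnorm f \<le> 1}. norm (\<phi> f))"

definition is_basis :: "(nat \<Rightarrow> 'a) \<Rightarrow> bool" where
  "is_basis x \<longleftrightarrow>
     (\<exists>M. \<forall>n\<ge>1. qnorm (x n) \<le> M) \<and>
     qdense (span (x ` {1..})) \<and>
     (\<exists>\<phi>. (\<forall>n\<ge>1. \<phi> n \<in> dual) \<and>
          (\<exists>M. \<forall>n\<ge>1. dual_norm (\<phi> n) \<le> M) \<and>
          (\<forall>n\<ge>1. \<forall>k\<ge>1. \<phi> n (x k) = (if n = k then 1 else 0)))"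

text \<open>The coordinate functional \<open>x\<^sub>n\<^sup>*\<close>; it is well defined by \<open>ex1_coord\<close> below.\<close>

definition coord :: "(nat \<Rightarrow> 'a) \<Rightarrow> nat \<Rightarrow> 'a \<Rightarrow> 'f" where
  "coord x n = (THE \<phi>. \<phi> \<in> dual \<and> (\<forall>k\<ge>1. \<phi> (x k) = (if n = k then 1 else 0)))"

definition coord_proj :: "(nat \<Rightarrow> 'a) \<Rightarrow> nat set \<Rightarrow> 'a \<Rightarrow> 'a" where
  "coord_proj x A f = (\<Sum>n\<in>A. scale (coord x n f) (x n))"

text \<open>The conventions are \<open>0 / 0 = 1\<close> and \<open>a / 0 = \<infinity>\<close> for \<open>a > 0\<close>, unlike division on
  \<^typ>\<open>real\<close> or \<^typ>\<open>ereal\<close>. Used for nonempty finite \<open>A\<close> only.\<close>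

definition osc :: "(nat \<Rightarrow> 'a) \<Rightarrow> 'a \<Rightarrow> nat set \<Rightarrow> ereal" where
  "osc x f A =
     (let M = (MAX n\<in>A. norm (coord x n f)); m = (MIN n\<in>A. norm (coord x n f))
      in if m = 0 then (if M = 0 then 1 else \<infinity>) else ereal (M / m))"

definition bounded_oscillation_unconditional_at ::
    "real \<Rightarrow> real \<Rightarrow> (nat \<Rightarrow> 'a) \<Rightarrow> bool" where
  "bounded_oscillation_unconditional_at D d x \<longleftrightarrow>
     (\<exists>C. \<forall>f A.
        A \<subseteq> {1..} \<and> finite A \<and> A \<noteq> {} \<and> osc x f A \<le> ereal D \<and>
        (\<exists>n\<ge>1. \<exists>As :: nat \<Rightarrow> nat set.
           A = (\<Union>j\<in>{1..n}. As j) \<and> disjoint_family_on As {1..n} \<and>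
           (\<forall>j\<in>{1..n}. As j \<noteq> {} \<and> osc x f (As j) \<le> ereal d) \<and>
           n \<le> Min (As 1) \<and>
           (\<forall>j\<in>{1..<n}. Max (As j) < Min (As (j + 1))))
        \<longrightarrow> qnorm (coord_proj x A f) \<le> C * qnorm f)"

definition bounded_oscillation_unconditional :: "(nat \<Rightarrow> 'a) \<Rightarrow> bool" where
  "bounded_oscillation_unconditional x \<longleftrightarrow>
     (\<forall>d D. 1 \<le> d \<and> d \<le> D \<longrightarrow> bounded_oscillation_unconditional_at D d x)"

definition greedy_set :: "(nat \<Rightarrow> 'a) \<Rightarrow> 'a \<Rightarrow> nat set \<Rightarrow> bool" where
  "greedy_set x f A \<longleftrightarrow>
     A \<subseteq> {1..} \<and> finite A \<and>
     (\<forall>n\<in>A. \<forall>k\<in>{1..} - A. norm (coord x k f) \<le> norm (coord x n f))"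

definition truncation_quasi_greedy :: "(nat \<Rightarrow> 'a) \<Rightarrow> bool" where
  "truncation_quasi_greedy x \<longleftrightarrow>
     (\<exists>C. \<forall>f A. greedy_set x f A \<and> A \<noteq> {} \<longrightarrow>
        (MIN n\<in>A. norm (coord x n f)) * qnorm (\<Sum>n\<in>A. scale (sign (coord x n f)) (x n))
          \<le> C * qnorm f)"

lemma ex1_coord:
  assumes "is_basis x" and "n \<ge> 1"
  shows "\<exists>!\<phi>. \<phi> \<in> dual \<and> (\<forall>k\<ge>1. \<phi> (x k) = (if n = k then 1 else 0))"
proof -
  have dense: "qdense (span (x ` {1..}))"
    using assms(1) by (simp add: is_basis_def)
  have ex: "\<exists>\<phi>. \<phi> \<in> dual \<and> (\<forall>k\<ge>1. \<phi> (x k) = (if n = k then 1 else 0))"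
  proof -
    obtain \<Phi> where "\<forall>n\<ge>1. \<Phi> n \<in> dual"
        "\<forall>n\<ge>1. \<forall>k\<ge>1. \<Phi> n (x k) = (if n = k then 1 else 0)"
      using assms(1) unfolding is_basis_def by (elim conjE exE)
    with assms(2) show ?thesis by (intro exI[of _ "\<Phi> n"]) simp
  qed
  have uniq: "\<phi> = \<psi>"
    if \<phi>: "\<phi> \<in> dual" "\<forall>k\<ge>1. \<phi> (x k) = (if n = k then 1 else 0)"
      and \<psi>: "\<psi> \<in> dual" "\<forall>k\<ge>1. \<psi> (x k) = (if n = k then 1 else 0)" for \<phi> \<psi>
  proof
    fix f
    obtain C1 where C1: "\<And>g. norm (\<phi> g) \<le> C1 * qnorm g" using \<phi>(1) by (auto simp: dual_def)
    obtain C2 where C2: "\<And>g. norm (\<psi> g) \<le> C2 * qnorm g" using \<psi>(1) by (auto simp: dual_def)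
    have lin: "Vector_Spaces.linear scale (*) \<phi>" "Vector_Spaces.linear scale (*) \<psi>"
      using \<phi>(1) \<psi>(1) by (auto simp: dual_def)
    interpret vp: vector_space_pair scale "(*) :: 'f \<Rightarrow> 'f \<Rightarrow> 'f"
      using lin(1) by (simp add: Vector_Spaces.linear_def vector_space_pair_def)
    have on_span: "\<phi> g = \<psi> g" if "g \<in> span (x ` {1..})" for g
    proof (rule vp.linear_eq_on[OF lin that])
      fix b assume "b \<in> x ` {1..}"
      then obtain k where "k \<ge> 1" "b = x k" by auto
      then show "\<phi> b = \<psi> b" using \<phi>(2) \<psi>(2) by simp
    qed
    define C where "C = \<bar>C1\<bar> + \<bar>C2\<bar> + 1"
    have Cpos: "C > 0" by (simp add: C_def)
    have "norm (\<phi> f - \<psi> f) \<le> e" if e: "e > 0" for e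
    proof -
      obtain g where g: "g \<in> span (x ` {1..})" "qnorm (f - g) < e / C"
        using dense divide_pos_pos[OF e Cpos] unfolding qdense_def by blast
      have "\<phi> f - \<psi> f = \<phi> (f - g) - \<psi> (f - g)"
        using on_span[OF g(1)] vp.linear_diff[OF lin(1)] vp.linear_diff[OF lin(2)] by simp
      also have "norm \<dots> \<le> norm (\<phi> (f - g)) + norm (\<psi> (f - g))"
        by (rule norm_triangle_ineq4)
      also have "\<dots> \<le> C1 * qnorm (f - g) + C2 * qnorm (f - g)"
        by (rule add_mono[OF C1 C2])
      also have "\<dots> = (C1 + C2) * qnorm (f - g)"
        by (simp add: algebra_simps)
      also have "\<dots> \<le> C * qnorm (f - g)"
        by (rule mult_right_mono) (auto simp: C_def qnorm_nonneg)
      also have "\<dots> \<le> e"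
        using g(2) Cpos by (simp add: field_simps)
      finally show ?thesis .
    qed
    then have "norm (\<phi> f - \<psi> f) \<le> 0"
      by (rule dense_ge)
    then show "\<phi> f = \<psi> f" by simp
  qed
  from ex obtain \<phi> where \<phi>: "\<phi> \<in> dual \<and> (\<forall>k\<ge>1. \<phi> (x k) = (if n = k then 1 else 0))" ..
  then show ?thesis
  proof (rule ex1I[of _ \<phi>])
    fix \<psi> assume "\<psi> \<in> dual \<and> (\<forall>k\<ge>1. \<psi> (x k) = (if n = k then 1 else 0))"
    then show "\<psi> = \<phi>"
      using \<phi> by (intro uniq) simp_all
  qed
qed

end

locale quasi_banach_space = quasi_normed_space +
  assumes complete: "qCauchy u \<Longrightarrow> qconvergent u"

end

theory Submission imports Defs begin

text \<open>
  Let \<open>\<kappa>\<close> be the modulus of concavity of the quasi-norm and write \<open>1\<^sub>A\<close> for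
  \<open>\<Sum>n\<in>A. sign (x\<^sub>n\<^sup>*(f)) x\<^sub>n\<close>. Everything passes through the inequality
  \<open>min\<^sub>A |x\<^sub>n\<^sup>*(f)| \<cdot> \<parallel>1\<^sub>A\<parallel> \<le> E \<parallel>f\<parallel>\<close> for \<^emph>\<open>all\<close> finite sets \<open>A\<close>, greedy or not.

  Under (1,1)-bounded-oscillation unconditionality, sums with coefficients in \<open>[0,1]\<close> are dominated
  by \<open>\<parallel>1\<^sub>A\<parallel>\<close>. If the moduli of the coefficients on \<open>A\<close> lie in \<open>[t, (1+\<delta>)t]\<close>, changing them to \<open>t\<close>
  perturbs \<open>f\<close> by at most a constant times \<open>\<delta> t \<parallel>1\<^sub>A\<parallel>\<close>, which for small \<open>\<delta>\<close> is absorbed in the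
  estimate for the perturbed vector. Finitely many such layers cover \<open>[t, 2\<kappa>t]\<close>, and the layers
  \<open>[(2\<kappa>)\<^sup>k t, (2\<kappa>)\<^sup>k\<^sup>+\<^sup>1 t]\<close> contribute a geometric series of ratio \<open>1/2\<close>.

  Conversely, if \<open>|x\<^sub>n\<^sup>*(f)| = t\<close> on \<open>A\<close>, then \<open>A\<close> is contained in the greedy set
  \<open>G = {n. |x\<^sub>n\<^sup>*(f)| \<ge> t}\<close> of \<open>f\<close> and is itself a greedy set of \<open>1\<^sub>G\<close>, so that truncation
  quasi-greediness can be applied twice.
\<close>

section \<open>Signs of scalars\<close>

lemma norm_sign [simp]: "norm (sign c) = 1"
  by (simp add: sign_def norm_divide)

lemma sign_times_norm: "of_real (norm c) * sign c = c"
  by (simp add: sign_def)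

lemma sign_sign [simp]: "sign (sign c) = sign c"
proof -
  have "sign c \<noteq> 0" using norm_sign[of c] by fastforce
  then show ?thesis by (simp add: sign_def[of "sign c"])
qed

lemma sign_of_real_mult:
  assumes "t > 0" shows "sign (of_real t * sign c) = sign c"
proof -
  have "sign c \<noteq> 0" using norm_sign[of c] by fastforce
  then show ?thesis using assms by (simp add: sign_def[of "of_real t * sign c"] norm_mult)
qed

section \<open>Quasi-norm estimates and dual functionals\<close>

context quasi_normed_space
begin

text \<open>The axiom \<open>qnorm_add\<close> only asserts that an admissible constant exists. One
  of them, not necessarily the least, is fixed so that later constants can be built from it.\<close>

definition concavity_modulus :: real where
  "concavity_modulus = (SOME \<kappa>. \<kappa> \<ge> 1 \<and> (\<forall>f g. qnorm (f + g) \<le> \<kappa> * (qnorm f + qnorm g)))"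

lemma concavity_modulus_ge_1: "concavity_modulus \<ge> 1"
  and qnorm_triangle: "qnorm (f + g) \<le> concavity_modulus * (qnorm f + qnorm g)"
  using someI_ex[OF qnorm_add] unfolding concavity_modulus_def by blast+

lemma qnorm_0 [simp]: "qnorm 0 = 0"
  by (simp add: qnorm_eq_0_iff)

lemma qnorm_scale_real:
  "c \<ge> 0 \<Longrightarrow> qnorm (scale (of_real c) f) = c * qnorm f"
  by (simp add: qnorm_scale)

text \<open>Splitting off one summand costs one factor \<kappa>. The constant depends on the number
  of summands, so the bound serves either for a number of summands fixed in advance or merely to
  obtain finiteness.\<close>

lemma qnorm_sum_le:
  "finite J \<Longrightarrow> qnorm (sum g J) \<le> concavity_modulus ^ card J * (\<Sum>j\<in>J. qnorm (g j))"
proof (induction J rule: finite_induct)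
  case empty
  then show ?case by simp
next
  case (insert j J)
  let ?k = concavity_modulus
  have "?k ^ card J \<ge> 1" using concavity_modulus_ge_1 by simp
  then have 1: "qnorm (g j) \<le> ?k ^ card J * qnorm (g j)"
    using mult_right_mono[OF _ qnorm_nonneg, of 1] by fastforce
  have "qnorm (sum g (insert j J)) \<le> ?k * (qnorm (g j) + qnorm (sum g J))"
    using insert qnorm_triangle by simp
  also have "\<dots> \<le> ?k * (?k ^ card J * qnorm (g j) + ?k ^ card J * (\<Sum>j\<in>J. qnorm (g j)))"
    using insert 1 concavity_modulus_ge_1 by (intro mult_left_mono add_mono) auto
  also have "\<dots> = ?k ^ card (insert j J) * (\<Sum>j\<in>insert j J. qnorm (g j))"
    using insert by (simp add: algebra_simps)
  finally show ?case .
qed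

text \<open>Writing \<open>c = d / b + c' / b\<close> with an integer digit \<open>d\<close> and \<open>c' \<in> [0,1]\<close> bounds the supremum \<open>K\<close>
  of the left-hand sides by \<open>\<kappa> (\<kappa>\<^sup>b M + K / b)\<close>; the term in \<open>K\<close> is absorbed because \<open>b \<ge> 2\<kappa>\<close>.\<close>

lemma bounded_coefficients:
  obtains K where "K \<ge> 1"
    "\<And>A y M c. finite A \<Longrightarrow> (\<And>B. B \<subseteq> A \<Longrightarrow> qnorm (sum y B) \<le> M) \<Longrightarrow>
       (\<And>n. n \<in> A \<Longrightarrow> 0 \<le> c n \<and> c n \<le> (1::real)) \<Longrightarrow>
       qnorm (\<Sum>n\<in>(A::nat set). scale (of_real (c n)) (y n)) \<le> K * M"
proof -
  let ?k = concavity_modulus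
  obtain b :: nat where b: "real b \<ge> 2 * ?k" using real_arch_simple by blast
  have b_pos: "b > 0"
    using b concavity_modulus_ge_1 by (cases "b = 0") auto
  define K where "K = 2 * ?k ^ Suc b"
  have "K \<ge> 1"
    using one_le_power[OF concavity_modulus_ge_1, of "Suc b"] unfolding K_def by linarith
  moreover have "qnorm (\<Sum>n\<in>A. scale (of_real (c n)) (y n)) \<le> K * M"
    if A: "finite A" and M: "\<And>B. B \<subseteq> A \<Longrightarrow> qnorm (sum y B) \<le> M"
      and c: "\<And>n. n \<in> A \<Longrightarrow> 0 \<le> c n \<and> c n \<le> 1"
    for A :: "nat set" and y M and c :: "nat \<Rightarrow> real"
  proof -
    define T where "T c = (\<Sum>n\<in>A. scale (of_real (c n)) (y n))" for c :: "nat \<Rightarrow> real"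
    define P where "P = {c :: nat \<Rightarrow> real. \<forall>n\<in>A. 0 \<le> c n \<and> c n \<le> 1}"
    define S where "S = (SUP c\<in>P. qnorm (T c))"
    \<comment> \<open>This bound depends on \<open>A\<close> and does not enter \<open>K\<close>. It
      makes \<open>S\<close> a genuine supremum over a bounded set, without which
      \<open>S / 2\<close> could not be absorbed.\<close>
    have "qnorm (T c) \<le> ?k ^ card A * (\<Sum>n\<in>A. qnorm (y n))" if "c \<in> P" for c
    proof -
      have "qnorm (T c) \<le> ?k ^ card A * (\<Sum>n\<in>A. qnorm (scale (of_real (c n)) (y n)))"
        unfolding T_def by (rule qnorm_sum_le[OF A])
      also have "\<dots> \<le> ?k ^ card A * (\<Sum>n\<in>A. qnorm (y n))"
        using that concavity_modulus_ge_1
        by (intro mult_left_mono sum_mono)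
          (auto simp: P_def qnorm_scale qnorm_nonneg mult_left_le_one_le)
      finally show ?thesis .
    qed
    then have bdd: "bdd_above ((\<lambda>c. qnorm (T c)) ` P)" by (intro bdd_aboveI2)
    have step: "qnorm (T c) \<le> ?k ^ Suc b * M + S / 2" if cP: "c \<in> P" for c
    proof -
      \<comment> \<open>The digit equals \<open>b\<close> exactly when \<open>c n = 1\<close>, so
        digits range over \<open>0..b\<close> and the decomposition below has the \<open>b\<close>
        levels \<open>1..b\<close>.\<close>
      define d where "d n = nat \<lfloor>real b * c n\<rfloor>" for n
      define c' where "c' n = real b * c n - real (d n)" for n
      have d: "real (d n) \<le> real b * c n" "real b * c n \<le> real (d n) + 1" "d n \<le> b"
        if "n \<in> A" for n
      proof -
        have c01: "0 \<le> c n" "c n \<le> 1" using that cP by (auto simp: P_def)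
        then have "real b * c n \<ge> 0" by simp
        then show 1: "real (d n) \<le> real b * c n" "real b * c n \<le> real (d n) + 1"
          unfolding d_def by linarith+
        have "real b * c n \<le> real b" using c01 by (simp add: mult_left_le)
        then show "d n \<le> b" using 1 by linarith
      qed
      have c': "c' \<in> P"
        unfolding P_def mem_Collect_eq c'_def using d(1,2) by (simp add: algebra_simps)
      \<comment> \<open>Layer-cake decomposition: \<open>d n\<close> counts the levels
        \<open>j\<close> with \<open>1 \<le> j \<le> d n\<close>. The result is a sum of
        \<open>b\<close> subset sums, each of quasi-norm at most \<open>M\<close>, where
        \<open>b\<close> is chosen from \<kappa> alone.\<close>
      have digits: "(\<Sum>n\<in>A. scale (of_nat (d n)) (y n)) = (\<Sum>j\<in>{1..b}. \<Sum>n\<in>{n\<in>A. j \<le> d n}. y n)"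
      proof -
        have "(\<Sum>j\<in>{1..b}. \<Sum>n\<in>{n\<in>A. j \<le> d n}. y n) =
            (\<Sum>j\<in>{1..b}. \<Sum>n\<in>A. if j \<le> d n then y n else 0)"
          using A by (simp add: sum.inter_filter)
        also have "\<dots> = (\<Sum>n\<in>A. \<Sum>j\<in>{1..b}. if j \<le> d n then y n else 0)"
          by (rule sum.swap)
        also have "\<dots> = (\<Sum>n\<in>A. scale (of_nat (d n)) (y n))"
        proof (rule sum.cong[OF refl])
          fix n assume "n \<in> A"
          then have "{j \<in> {1..b}. j \<le> d n} = {1..d n}" using d(3) by fastforce
          then have "(\<Sum>j\<in>{1..b}. if j \<le> d n then y n else 0) = (\<Sum>j\<in>{1..d n}. y n)"
            by (simp flip: sum.inter_filter)
          then show "(\<Sum>j\<in>{1..b}. if j \<le> d n then y n else 0) = scale (of_nat (d n)) (y n)"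
            by (simp add: sum_constant_scale)
        qed
        finally show ?thesis ..
      qed
      have "c n = (1 / real b) * real (d n) + (1 / real b) * c' n" for n
        using b_pos by (simp add: c'_def field_simps)
      then have "T c = T (\<lambda>n. (1 / real b) * real (d n) + (1 / real b) * c' n)" by presburger
      then have split: "T c = scale (of_real (1 / real b)) (\<Sum>n\<in>A. scale (of_nat (d n)) (y n)) +
          scale (of_real (1 / real b)) (T c')"
        by (simp add: T_def scale_sum_right scale_left_distrib sum.distrib)
      have "qnorm (\<Sum>n\<in>A. scale (of_nat (d n)) (y n)) \<le>
          ?k ^ b * (\<Sum>j\<in>{1..b}. qnorm (\<Sum>n\<in>{n\<in>A. j \<le> d n}. y n))"
        unfolding digits using qnorm_sum_le[of "{1..b}"] by simp
      also have "\<dots> \<le> ?k ^ b * (\<Sum>j\<in>{1..b}. M)"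
        using concavity_modulus_ge_1 by (intro mult_left_mono sum_mono M) auto
      finally have 1: "(1 / real b) * qnorm (\<Sum>n\<in>A. scale (of_nat (d n)) (y n)) \<le> ?k ^ b * M"
        using b_pos by (simp add: field_simps)
      have "qnorm (T c') \<le> S"
        unfolding S_def using c' bdd by (intro cSUP_upper)
      then have 2: "(1 / real b) * qnorm (T c') \<le> (1 / real b) * S"
        by (intro mult_left_mono) auto
      have S0: "S \<ge> 0" using \<open>qnorm (T c') \<le> S\<close> qnorm_nonneg order_trans by blast
      have "qnorm (T c) \<le> ?k * ((1 / real b) * qnorm (\<Sum>n\<in>A. scale (of_nat (d n)) (y n)) +
          (1 / real b) * qnorm (T c'))"
        unfolding split
        by (rule order_trans[OF qnorm_triangle]) (subst (1 2) qnorm_scale_real, simp_all)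
      also have "\<dots> \<le> ?k * (?k ^ b * M + (1 / real b) * S)"
        using concavity_modulus_ge_1 by (intro mult_left_mono add_mono 1 2) simp
      also have "\<dots> = ?k ^ Suc b * M + (?k / real b) * S" by (simp add: algebra_simps)
      also have "\<dots> \<le> ?k ^ Suc b * M + (1 / 2) * S"
        using b b_pos S0 by (intro add_left_mono mult_right_mono) (auto simp: field_simps)
      finally show ?thesis by simp
    qed
    have "c \<in> P" using c by (auto simp: P_def)
    then have "(SUP c\<in>P. qnorm (T c)) \<le> ?k ^ Suc b * M + S / 2"
      by (intro cSUP_least step) auto
    then have "S \<le> ?k ^ Suc b * M + S / 2" by (fold S_def)
    then have "S \<le> K * M" by (simp add: K_def)
    moreover have "qnorm (T c) \<le> S"
      unfolding S_def using \<open>c \<in> P\<close> bdd by (intro cSUP_upper)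
    ultimately show ?thesis by (simp add: T_def)
  qed
  ultimately show ?thesis by (rule that[of K])
qed

text \<open>A real supremum is informative only over a set that is bounded above. The constant
  provided by membership in \<open>dual\<close> bounds the set, and homogeneity reduces a nonzero
  \<open>f\<close> to quasi-norm 1.\<close>

lemma dual_norm_bound:
  assumes "\<phi> \<in> dual"
  shows "norm (\<phi> f) \<le> dual_norm \<phi> * qnorm f"
proof -
  obtain C where C: "\<And>g. norm (\<phi> g) \<le> C * qnorm g" using assms by (auto simp: dual_def)
  have lin: "Vector_Spaces.linear scale (*) \<phi>" using assms by (auto simp: dual_def)
  have bdd: "bdd_above ((\<lambda>f. norm (\<phi> f)) ` {f. qnorm f \<le> 1})"
  proof (rule bdd_aboveI2)
    fix g assume "g \<in> {f. qnorm f \<le> 1}"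
    then have "\<bar>C\<bar> * qnorm g \<le> \<bar>C\<bar>" using qnorm_nonneg[of g] by (simp add: mult_left_le)
    moreover have "C * qnorm g \<le> \<bar>C\<bar> * qnorm g" by (intro mult_right_mono) (auto simp: qnorm_nonneg)
    ultimately show "norm (\<phi> g) \<le> \<bar>C\<bar>" using C[of g] by linarith
  qed
  show ?thesis
  proof (cases "qnorm f = 0")
    case True
    then show ?thesis using C[of f] by simp
  next
    case False
    then have pos: "qnorm f > 0" using qnorm_nonneg[of f] by simp
    define g where "g = scale (of_real (1 / qnorm f)) f"
    have "qnorm g = (1 / qnorm f) * qnorm f"
      unfolding g_def using pos by (intro qnorm_scale_real) simp
    then have "norm (\<phi> g) \<le> dual_norm \<phi>"
      unfolding dual_norm_def using bdd pos by (intro cSUP_upper) auto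
    moreover have "\<phi> g = of_real (1 / qnorm f) * \<phi> f"
      using lin by (simp add: g_def Vector_Spaces.linear_iff)
    ultimately show ?thesis using pos by (simp add: norm_mult norm_divide field_simps)
  qed
qed

end

section \<open>Bases, coordinate functionals and oscillation\<close>

locale quasi_normed_basis = quasi_normed_space +
  fixes x
  assumes basis: "is_basis x"
begin

lemma coord_dual: "n \<ge> 1 \<Longrightarrow> coord x n \<in> dual"
  and coord_basis: "n \<ge> 1 \<Longrightarrow> k \<ge> 1 \<Longrightarrow> coord x n (x k) = (if n = k then 1 else 0)"
  using theI'[OF ex1_coord[OF basis, of n]] by (auto simp: coord_def)

lemma coord_linear: "n \<ge> 1 \<Longrightarrow> Vector_Spaces.linear scale (*) (coord x n)"
  using coord_dual by (auto simp: dual_def)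

lemma coord_add: "n \<ge> 1 \<Longrightarrow> coord x n (f + g) = coord x n f + coord x n g"
  using coord_linear by (simp add: Vector_Spaces.linear_iff)

lemma coord_scale: "n \<ge> 1 \<Longrightarrow> coord x n (scale c f) = c * coord x n f"
  using coord_linear by (simp add: Vector_Spaces.linear_iff)

lemma coord_0: "n \<ge> 1 \<Longrightarrow> coord x n 0 = 0"
  using coord_scale[of n 0 0] by simp

lemma coord_diff: "n \<ge> 1 \<Longrightarrow> coord x n (f - g) = coord x n f - coord x n g"
  using coord_add[of n f "scale (-1) g"] coord_scale[of n "-1" g] by simp

lemma coord_sum:
  assumes "n \<ge> 1" "finite A" "A \<subseteq> {1..}"
  shows "coord x n (\<Sum>k\<in>A. scale (c k) (x k)) = (if n \<in> A then c n else 0)"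
  using assms(2,3)
proof (induction A rule: finite_induct)
  case empty
  then show ?case using assms(1) by (simp add: coord_0)
next
  case (insert k A)
  then show ?case using assms(1) by (auto simp: coord_add coord_scale coord_basis)
qed

text \<open>\<open>is_basis\<close> bounds the dual norms of some biorthogonal sequence; uniqueness
  of the coordinate functionals transfers this bound to \<open>coord\<close>.\<close>

lemma coord_bounded:
  obtains M where "M > 0" "\<And>n f. n \<ge> 1 \<Longrightarrow> norm (coord x n f) \<le> M * qnorm f"
proof -
  obtain \<phi> M where \<phi>: "\<And>n. n \<ge> 1 \<Longrightarrow> \<phi> n \<in> dual" "\<And>n. n \<ge> 1 \<Longrightarrow> dual_norm (\<phi> n) \<le> M"
      "\<And>n k. n \<ge> 1 \<Longrightarrow> k \<ge> 1 \<Longrightarrow> \<phi> n (x k) = (if n = k then 1 else 0)"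
    using basis unfolding is_basis_def by blast
  have "norm (coord x n f) \<le> (\<bar>M\<bar> + 1) * qnorm f" if n: "n \<ge> 1" for n f
  proof -
    have "coord x n = \<phi> n"
      unfolding coord_def using \<phi> n by (intro the1_equality[OF ex1_coord[OF basis n]]) auto
    then have "norm (coord x n f) \<le> dual_norm (\<phi> n) * qnorm f"
      using dual_norm_bound \<phi>(1) n by simp
    also have "\<dots> \<le> (\<bar>M\<bar> + 1) * qnorm f"
      using \<phi>(2)[OF n] by (intro mult_right_mono qnorm_nonneg) linarith
    finally show ?thesis .
  qed
  then show ?thesis using that[of "\<bar>M\<bar> + 1"] by fastforce
qed

text \<open>A vector \<open>g\<close> of the span has finitely many nonzero coordinates, and if
  \<open>g\<close> is close to \<open>f\<close>, the uniform bound on the functionals keeps all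
  coordinates of \<open>f - g\<close> below \<open>t\<close>. This makes superlevel sets of the
  coefficients available as greedy sets, which have to be finite.\<close>

lemma finite_coord_ge:
  assumes "t > 0"
  shows "finite {n. n \<ge> 1 \<and> t \<le> norm (coord x n f)}"
proof -
  obtain M where M: "M > 0" "\<And>n f. n \<ge> 1 \<Longrightarrow> norm (coord x n f) \<le> M * qnorm f"
    using coord_bounded by blast
  have "t / M > 0" using assms M(1) by simp
  then obtain g where g: "g \<in> span (x ` {1..})" "qnorm (f - g) < t / M"
    using basis unfolding is_basis_def qdense_def by blast
  have "finite {n. n \<ge> 1 \<and> coord x n g \<noteq> 0}"
    using g(1)
  proof (induction rule: span_induct_alt)
    case base
    have "{n. n \<ge> 1 \<and> coord x n 0 \<noteq> 0} = {}" using coord_0 by blast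
    then show ?case by (metis finite.emptyI)
  next
    case (step c b h)
    then obtain k where k: "k \<ge> 1" "b = x k" by auto
    have "{n. n \<ge> 1 \<and> coord x n (scale c b + h) \<noteq> 0} \<subseteq> insert k {n. n \<ge> 1 \<and> coord x n h \<noteq> 0}"
      using k by (auto simp: coord_add coord_scale coord_basis split: if_splits)
    then show ?case using step by (meson finite_insert finite_subset)
  qed
  moreover have "{n. n \<ge> 1 \<and> t \<le> norm (coord x n f)} \<subseteq> {n. n \<ge> 1 \<and> coord x n g \<noteq> 0}"
  proof safe
    fix n assume n: "n \<ge> 1" "t \<le> norm (coord x n f)" "coord x n g = 0"
    then have "t \<le> norm (coord x n (f - g))" by (simp add: coord_diff)
    also have "\<dots> \<le> M * qnorm (f - g)" using M(2) n(1) .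
    also have "\<dots> < t" using g(2) M(1) by (simp add: field_simps)
    finally show False by simp
  qed
  ultimately show ?thesis by (rule finite_subset[rotated])
qed

lemma osc_le_iff:
  assumes "finite A" "A \<noteq> {}" "1 \<le> D"
  shows "osc x f A \<le> ereal D \<longleftrightarrow> (\<forall>m\<in>A. \<forall>n\<in>A. norm (coord x n f) \<le> D * norm (coord x m f))"
proof -
  let ?a = "\<lambda>n. norm (coord x n f)"
  define M where "M = Max (?a ` A)"
  define m where "m = Min (?a ` A)"
  have M: "M \<in> ?a ` A" "\<And>n. n \<in> A \<Longrightarrow> ?a n \<le> M"
    using assms unfolding M_def by (auto intro!: Max_in)
  have m: "m \<in> ?a ` A" "\<And>n. n \<in> A \<Longrightarrow> m \<le> ?a n"
    using assms unfolding m_def by (auto intro!: Min_in)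
  have m0: "m \<ge> 0" using m(1) by auto
  have mM: "m \<le> M" using m M by force
  have "(\<forall>m\<in>A. \<forall>n\<in>A. ?a n \<le> D * ?a m) \<longleftrightarrow> M \<le> D * m"
  proof
    assume "M \<le> D * m"
    show "\<forall>m\<in>A. \<forall>n\<in>A. ?a n \<le> D * ?a m"
    proof (intro ballI)
      fix k n assume kn: "k \<in> A" "n \<in> A"
      then have "D * m \<le> D * ?a k" using m(2) assms(3) by (intro mult_left_mono) auto
      then show "?a n \<le> D * ?a k" using M(2) kn \<open>M \<le> D * m\<close> by fastforce
    qed
  qed (use M(1) m(1) in auto)
  moreover have "osc x f A \<le> ereal D \<longleftrightarrow> M \<le> D * m"
    unfolding osc_def Let_def M_def[symmetric] m_def[symmetric]
  proof (cases "m = 0")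
    case True
    then show "(if m = 0 then if M = 0 then 1 else \<infinity> else ereal (M / m)) \<le> ereal D \<longleftrightarrow> M \<le> D * m"
      using mM assms(3) by (simp add: one_ereal_def)
  next
    case False
    then show "(if m = 0 then if M = 0 then 1 else \<infinity> else ereal (M / m)) \<le> ereal D \<longleftrightarrow> M \<le> D * m"
      using m0 by (simp add: pos_divide_le_eq)
  qed
  ultimately show ?thesis by simp
qed

section \<open>Sign sums (the vectors 1_A) under the (1,1) hypothesis\<close>

definition sign_sum where
  "sign_sum f A = (\<Sum>n\<in>A. scale (sign (coord x n f)) (x n))"

lemma coord_proj_eq_scale_sign_sum:
  assumes "\<And>n. n \<in> A \<Longrightarrow> norm (coord x n f) = t"
  shows "coord_proj x A f = scale (of_real t) (sign_sum f A)"
  unfolding coord_proj_def sign_sum_def scale_sum_right scale_scale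
proof (rule sum.cong[OF refl])
  fix n assume "n \<in> A"
  then have "of_real t * sign (coord x n f) = coord x n f"
    using assms sign_times_norm[of "coord x n f"] by simp
  then show "scale (coord x n f) (x n) = scale (of_real t * sign (coord x n f)) (x n)" by simp
qed

text \<open>A nonempty set on which the coefficients have constant modulus has oscillation 1 and is
  a partition of itself into one block, for which \<open>n \<le> Min (As 1)\<close> becomes
  \<open>1 \<le> Min A\<close>. The projection is then \<open>t\<close> times the sign sum.\<close>

lemma bounded_oscillation_unconditional_at_1_1D:
  assumes "bounded_oscillation_unconditional_at 1 1 x"
  obtains C where "C > 0"
    "\<And>f A t. A \<subseteq> {1..} \<Longrightarrow> finite A \<Longrightarrow> t \<ge> 0 \<Longrightarrow> (\<And>n. n \<in> A \<Longrightarrow> norm (coord x n f) = t) \<Longrightarrow>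
       t * qnorm (sign_sum f A) \<le> C * qnorm f"
proof -
  obtain C where C: "\<forall>f A.
        A \<subseteq> {1..} \<and> finite A \<and> A \<noteq> {} \<and> osc x f A \<le> ereal 1 \<and>
        (\<exists>n\<ge>1. \<exists>As :: nat \<Rightarrow> nat set.
           A = (\<Union>j\<in>{1..n}. As j) \<and> disjoint_family_on As {1..n} \<and>
           (\<forall>j\<in>{1..n}. As j \<noteq> {} \<and> osc x f (As j) \<le> ereal 1) \<and>
           n \<le> Min (As 1) \<and>
           (\<forall>j\<in>{1..<n}. Max (As j) < Min (As (j + 1))))
        \<longrightarrow> qnorm (coord_proj x A f) \<le> C * qnorm f"
    using assms unfolding bounded_oscillation_unconditional_at_def ..
  have "t * qnorm (sign_sum f A) \<le> (\<bar>C\<bar> + 1) * qnorm f"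
    if A: "A \<subseteq> {1..}" "finite A" "t \<ge> 0" "\<And>n. n \<in> A \<Longrightarrow> norm (coord x n f) = t" for f A t
  proof (cases "A = {}")
    case True
    then show ?thesis by (simp add: sign_sum_def qnorm_nonneg)
  next
    case False
    have osc: "osc x f A \<le> ereal 1" using A False by (subst osc_le_iff) auto
    have "qnorm (coord_proj x A f) \<le> C * qnorm f"
    proof (rule C[rule_format], intro conjI exI[of _ "1::nat"] exI[of _ "\<lambda>_. A"])
      show "1 \<le> Min A" using A False by (subst Min_ge_iff) auto
    qed (use A(1,2) False osc in \<open>simp_all add: disjoint_family_on_def\<close>)
    also have "\<dots> \<le> (\<bar>C\<bar> + 1) * qnorm f" by (intro mult_right_mono qnorm_nonneg) simp
    finally show ?thesis
      using A by (simp add: coord_proj_eq_scale_sign_sum qnorm_scale)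
  qed
  then show ?thesis by (intro that[of "\<bar>C\<bar> + 1"]) auto
qed

text \<open>On \<open>A\<close> all coordinates of \<open>sign_sum f A\<close> have modulus 1, so
  the hypothesis, applied to this vector instead of \<open>f\<close>, bounds every subset sum. Then
  \<open>bounded_coefficients\<close> passes to coefficients in [0,1].\<close>

lemma sign_sum_uniform:
  assumes "bounded_oscillation_unconditional_at 1 1 x"
  obtains K where "K > 0"
    "\<And>f A c. A \<subseteq> {1..} \<Longrightarrow> finite A \<Longrightarrow> (\<And>n. n \<in> A \<Longrightarrow> 0 \<le> c n \<and> c n \<le> 1) \<Longrightarrow>
       qnorm (\<Sum>n\<in>A. scale (of_real (c n) * sign (coord x n f)) (x n)) \<le> K * qnorm (sign_sum f A)"
proof -
  obtain C where C: "C > 0"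
    "\<And>f A t. A \<subseteq> {1..} \<Longrightarrow> finite A \<Longrightarrow> t \<ge> 0 \<Longrightarrow> (\<And>n. n \<in> A \<Longrightarrow> norm (coord x n f) = t) \<Longrightarrow>
       t * qnorm (sign_sum f A) \<le> C * qnorm f"
    using bounded_oscillation_unconditional_at_1_1D[OF assms] by blast
  obtain K where K: "K \<ge> 1"
    "\<And>A y M c. finite A \<Longrightarrow> (\<And>B. B \<subseteq> A \<Longrightarrow> qnorm (sum y B) \<le> M) \<Longrightarrow>
       (\<And>n. n \<in> A \<Longrightarrow> 0 \<le> c n \<and> c n \<le> (1::real)) \<Longrightarrow>
       qnorm (\<Sum>n\<in>(A::nat set). scale (of_real (c n)) (y n)) \<le> K * M"
    using bounded_coefficients by blast
  show ?thesis
  proof (rule that[of "K * C"])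
    show "K * C > 0" using K(1) C(1) by simp
  next
    fix f and A :: "nat set" and c
    assume A: "A \<subseteq> {1..}" "finite A" and c: "\<And>n. n \<in> A \<Longrightarrow> 0 \<le> c n \<and> c n \<le> (1::real)"
    have "qnorm (\<Sum>n\<in>B. scale (sign (coord x n f)) (x n)) \<le> C * qnorm (sign_sum f A)"
      if "B \<subseteq> A" for B
    proof -
      have coord: "coord x n (sign_sum f A) = sign (coord x n f)" if "n \<in> B" for n
        unfolding sign_sum_def using A \<open>B \<subseteq> A\<close> that by (subst coord_sum) auto
      have "1 * qnorm (sign_sum (sign_sum f A) B) \<le> C * qnorm (sign_sum f A)"
        using A that finite_subset coord by (intro C(2)) auto
      moreover have "sign_sum (sign_sum f A) B = (\<Sum>n\<in>B. scale (sign (coord x n f)) (x n))"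
        unfolding sign_sum_def[of _ B] using coord by (intro sum.cong) auto
      ultimately show ?thesis by simp
    qed
    then have "qnorm (\<Sum>n\<in>A. scale (of_real (c n)) (scale (sign (coord x n f)) (x n)))
        \<le> K * (C * qnorm (sign_sum f A))"
      using A(2) c by (intro K(2))
    then show "qnorm (\<Sum>n\<in>A. scale (of_real (c n) * sign (coord x n f)) (x n)) \<le>
        (K * C) * qnorm (sign_sum f A)"
      by (simp add: mult.assoc)
  qed
qed

section \<open>Layers of comparable coefficients and arbitrary finite sets\<close>

definition layer_bound :: "real \<Rightarrow> real \<Rightarrow> bool" where
  "layer_bound D E \<longleftrightarrow> (\<forall>f A t. A \<subseteq> {1..} \<longrightarrow> finite A \<longrightarrow> t > 0 \<longrightarrow>
     (\<forall>n\<in>A. t \<le> norm (coord x n f) \<and> norm (coord x n f) \<le> D * t) \<longrightarrow>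
     t * qnorm (sign_sum f A) \<le> E * qnorm f)"

lemma layer_boundD:
  assumes "layer_bound D E" "A \<subseteq> {1..}" "finite A" "t > 0"
    "\<And>n. n \<in> A \<Longrightarrow> t \<le> norm (coord x n f) \<and> norm (coord x n f) \<le> D * t"
  shows "t * qnorm (sign_sum f A) \<le> E * qnorm f"
  using assms by (auto simp: layer_bound_def)

lemma sign_sum_layer:
  assumes "bounded_oscillation_unconditional_at 1 1 x"
  obtains r E where "r > 1" "E > 0" "layer_bound r E"
proof -
  let ?k = concavity_modulus
  obtain C where C: "C > 0"
    "\<And>f A t. A \<subseteq> {1..} \<Longrightarrow> finite A \<Longrightarrow> t \<ge> 0 \<Longrightarrow> (\<And>n. n \<in> A \<Longrightarrow> norm (coord x n f) = t) \<Longrightarrow>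
       t * qnorm (sign_sum f A) \<le> C * qnorm f"
    using bounded_oscillation_unconditional_at_1_1D[OF assms] by blast
  obtain K where K: "K > 0"
    "\<And>f A c. A \<subseteq> {1..} \<Longrightarrow> finite A \<Longrightarrow> (\<And>n. n \<in> A \<Longrightarrow> 0 \<le> c n \<and> c n \<le> 1) \<Longrightarrow>
       qnorm (\<Sum>n\<in>A. scale (of_real (c n) * sign (coord x n f)) (x n)) \<le> K * qnorm (sign_sum f A)"
    using sign_sum_uniform[OF assms] by blast
  have k: "?k > 0" using concavity_modulus_ge_1 by linarith
  \<comment> \<open>Chosen so that the error term below is exactly half of the left-hand side, as
    recorded in \<open>\<delta>_eq\<close>.\<close>
  define \<delta> where "\<delta> = 1 / (2 * C * ?k * K)"
  have \<delta>: "\<delta> > 0" using C(1) K(1) k by (simp add: \<delta>_def)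
  have \<delta>_eq: "C * ?k * (\<delta> * K) = 1 / 2" using C(1) K(1) k by (simp add: \<delta>_def field_simps)
  have "t * qnorm (sign_sum f A) \<le> (2 * C * ?k) * qnorm f"
    if A: "A \<subseteq> {1..}" "finite A" and t: "t > 0"
      and f: "\<And>n. n \<in> A \<Longrightarrow> t \<le> norm (coord x n f) \<and> norm (coord x n f) \<le> (1 + \<delta>) * t" for f A t
  proof -
    \<comment> \<open>On \<open>A\<close>, \<open>\<delta> * t * c n\<close> is the excess of the
      modulus over \<open>t\<close>. Subtracting \<open>\<delta> * t\<close> times \<open>h\<close>
      therefore flattens the moduli on \<open>A\<close> to \<open>t\<close> and keeps the signs,
      while \<open>c n\<close> in [0,1] lets \<open>sign_sum f A\<close> control
      \<open>h\<close>.\<close>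
    define c where "c n = (norm (coord x n f) - t) / (\<delta> * t)" for n
    define h where "h = (\<Sum>n\<in>A. scale (of_real (c n) * sign (coord x n f)) (x n))"
    define g where "g = f + scale (- of_real (\<delta> * t)) h"
    have c: "0 \<le> c n \<and> c n \<le> 1" if "n \<in> A" for n
      using f[OF that] t \<delta> by (auto simp: c_def field_simps)
    have coord: "coord x n g = of_real t * sign (coord x n f)" if "n \<in> A" for n
    proof -
      have "n \<ge> 1" using A that by auto
      then have "coord x n g = coord x n f - of_real (\<delta> * t) * (of_real (c n) * sign (coord x n f))"
        using A that unfolding g_def h_def coord_add[OF \<open>n \<ge> 1\<close>] coord_scale[OF \<open>n \<ge> 1\<close>]
        by (subst coord_sum) auto
      also have "\<dots> = of_real (norm (coord x n f)) * sign (coord x n f) -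
          of_real (\<delta> * t * c n) * sign (coord x n f)"
        by (simp add: sign_times_norm)
      also have "\<delta> * t * c n = norm (coord x n f) - t" using \<delta> t by (simp add: c_def)
      finally show ?thesis by (simp add: algebra_simps)
    qed
    have "t * qnorm (sign_sum g A) \<le> C * qnorm g"
      using A t coord by (intro C(2)) (auto simp: norm_mult)
    moreover have "sign_sum g A = sign_sum f A"
      unfolding sign_sum_def using coord t by (intro sum.cong) (auto simp: sign_of_real_mult)
    ultimately have g: "t * qnorm (sign_sum f A) \<le> C * qnorm g" by simp
    have "qnorm (scale (- of_real (\<delta> * t)) h) = (\<delta> * t) * qnorm h"
      using \<delta> t by (simp only: qnorm_scale norm_minus_cancel norm_of_real) simp
    then have "qnorm g \<le> ?k * (qnorm f + (\<delta> * t) * qnorm h)"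
      unfolding g_def by (metis qnorm_triangle)
    then have "C * qnorm g \<le> C * (?k * (qnorm f + (\<delta> * t) * qnorm h))"
      using C(1) by (intro mult_left_mono) auto
    with g have "t * qnorm (sign_sum f A) \<le> C * (?k * (qnorm f + (\<delta> * t) * qnorm h))" by simp
    also have "\<dots> \<le> C * (?k * (qnorm f + (\<delta> * t) * (K * qnorm (sign_sum f A))))"
      unfolding h_def using C(1) k \<delta> t A c
      by (intro mult_left_mono add_left_mono K(2)) auto
    also have "\<dots> = C * ?k * qnorm f + (C * ?k * (\<delta> * K)) * (t * qnorm (sign_sum f A))"
      by (simp add: algebra_simps)
    also have "\<dots> = C * ?k * qnorm f + t * qnorm (sign_sum f A) / 2"
      unfolding \<delta>_eq by simp
    finally show ?thesis by simp
  qed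
  then have "layer_bound (1 + \<delta>) (2 * C * ?k)" unfolding layer_bound_def by simp
  then show ?thesis using that[of "1 + \<delta>" "2 * C * ?k"] \<delta> C(1) k by simp
qed

lemma qnorm_sign_sum_split:
  assumes "finite A"
  shows "qnorm (sign_sum f A) \<le> concavity_modulus *
    (qnorm (sign_sum f {n\<in>A. P n}) + qnorm (sign_sum f {n\<in>A. \<not> P n}))"
proof -
  have "sign_sum f A = sign_sum f {n\<in>A. P n} + sign_sum f {n\<in>A. \<not> P n}"
    unfolding sign_sum_def using assms
    by (subst sum.union_disjoint[symmetric]) (auto intro!: sum.cong)
  then show ?thesis using qnorm_triangle by simp
qed

lemma sign_sum_bounded_oscillation:
  assumes "bounded_oscillation_unconditional_at 1 1 x"
  obtains E where "E > 0" "layer_bound D E"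
proof -
  let ?k = concavity_modulus
  have k: "?k > 0" using concavity_modulus_ge_1 by linarith
  obtain r E where r: "r > 1" and E: "E > 0" "layer_bound r E"
    using sign_sum_layer[OF assms] .
  \<comment> \<open>A layer of ratio \<open>r ^ Suc (Suc i)\<close> is cut at \<open>r * t\<close>:
    below lies a layer of ratio \<open>r\<close>, above a layer of ratio \<open>r ^ Suc i\<close>
    based at \<open>r * t\<close>. The growth of the constant with \<open>i\<close> is harmless,
    since the \<open>i\<close> finally chosen depends only on \<open>D\<close> and
    \<open>r\<close>.\<close>
  have layers: "\<exists>E'>0. layer_bound (r ^ Suc i) E'" for i
  proof (induction i)
    case 0
    then show ?case using E by auto
  next
    case (Suc i)
    then obtain E' where E': "E' > 0" "layer_bound (r ^ Suc i) E'" by blast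
    have "layer_bound (r ^ Suc (Suc i)) (?k * (E + E'))"
      unfolding layer_bound_def
    proof (intro allI impI)
      fix f A and t :: real
      assume A: "A \<subseteq> {1..}" "finite A" and t: "t > 0"
        and f: "\<forall>n\<in>A. t \<le> norm (coord x n f) \<and> norm (coord x n f) \<le> r ^ Suc (Suc i) * t"
      let ?P = "\<lambda>n. norm (coord x n f) \<le> r * t"
      have rt: "t \<le> r * t" "0 < r * t" using r t by simp_all
      have low: "t * qnorm (sign_sum f {n\<in>A. ?P n}) \<le> E * qnorm f"
        using A t f by (intro layer_boundD[OF E(2)]) auto
      have "t * qnorm (sign_sum f {n\<in>A. \<not> ?P n}) \<le> (r * t) * qnorm (sign_sum f {n\<in>A. \<not> ?P n})"
        using rt by (intro mult_right_mono qnorm_nonneg)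
      also have "\<dots> \<le> E' * qnorm f"
      proof (rule layer_boundD[OF E'(2)])
        fix n assume "n \<in> {n\<in>A. \<not> ?P n}"
        then have "\<not> ?P n" "norm (coord x n f) \<le> r ^ Suc (Suc i) * t" using f by auto
        moreover have "r ^ Suc (Suc i) * t = r ^ Suc i * (r * t)" by simp
        ultimately show "r * t \<le> norm (coord x n f) \<and> norm (coord x n f) \<le> r ^ Suc i * (r * t)"
          by linarith
      qed (use A rt in auto)
      finally have high: "t * qnorm (sign_sum f {n\<in>A. \<not> ?P n}) \<le> E' * qnorm f" .
      have "t * qnorm (sign_sum f A) \<le>
          t * (?k * (qnorm (sign_sum f {n\<in>A. ?P n}) + qnorm (sign_sum f {n\<in>A. \<not> ?P n})))"
        using A t by (intro mult_left_mono qnorm_sign_sum_split) auto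
      also have "\<dots> = ?k * (t * qnorm (sign_sum f {n\<in>A. ?P n}) + t * qnorm (sign_sum f {n\<in>A. \<not> ?P n}))"
        by (simp add: algebra_simps)
      also have "\<dots> \<le> ?k * (E * qnorm f + E' * qnorm f)"
        using k low high by (intro mult_left_mono add_mono) auto
      finally show "t * qnorm (sign_sum f A) \<le> ?k * (E + E') * qnorm f"
        by (simp add: algebra_simps)
    qed
    moreover have "?k * (E + E') > 0" using k E(1) E'(1) by simp
    ultimately show ?case by blast
  qed
  obtain i where i: "D < r ^ i" using real_arch_pow[OF r] by blast
  also have "r ^ i \<le> r ^ Suc i" using r by (intro power_increasing) auto
  finally have D: "D \<le> r ^ Suc i" by simp
  obtain E' where E': "E' > 0" "layer_bound (r ^ Suc i) E'"
    using layers[of i] by blast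
  have "layer_bound D E'"
    unfolding layer_bound_def
  proof (intro allI impI)
    fix f A and t :: real
    assume A: "A \<subseteq> {1..}" "finite A" and t: "t > 0"
      and f: "\<forall>n\<in>A. t \<le> norm (coord x n f) \<and> norm (coord x n f) \<le> D * t"
    have "D * t \<le> r ^ Suc i * t" using D t by (intro mult_right_mono) auto
    then have "t \<le> norm (coord x n f) \<and> norm (coord x n f) \<le> r ^ Suc i * t" if "n \<in> A" for n
      using f that by (meson order_trans)
    then show "t * qnorm (sign_sum f A) \<le> E' * qnorm f"
      by (rule layer_boundD[OF E'(2) A t])
  qed
  with E'(1) show ?thesis by (rule that)
qed

text \<open>Sums the geometric series by induction on \<open>A\<close>. The set is cut at
  \<open>D * s\<close>, where \<open>s\<close> is the minimum modulus; the upper part obeys the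
  induction hypothesis at level \<open>D * s\<close>, and dividing by \<open>D\<close> leaves the
  constant \<open>E\<close>.\<close>

lemma sign_sum_lower_bound:
  assumes "bounded_oscillation_unconditional_at 1 1 x"
  obtains E where "E > 0"
    "\<And>f A t. A \<subseteq> {1..} \<Longrightarrow> finite A \<Longrightarrow> t \<ge> 0 \<Longrightarrow> (\<And>n. n \<in> A \<Longrightarrow> t \<le> norm (coord x n f)) \<Longrightarrow>
       t * qnorm (sign_sum f A) \<le> E * qnorm f"
proof -
  let ?k = concavity_modulus
  have k: "?k \<ge> 1" by (rule concavity_modulus_ge_1)
  \<comment> \<open>With this ratio, \<kappa> (E + E) equals \<open>D * E\<close>, so the constant
    does not grow along the induction.\<close>
  define D where "D = 2 * ?k"
  have D: "D > 1" using k by (simp add: D_def)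
  obtain E where E: "E > 0" "layer_bound D E"
    using sign_sum_bounded_oscillation[OF assms] .
  have pos: "t * qnorm (sign_sum f A) \<le> (D * E) * qnorm f"
    if "A \<subseteq> {1..}" "finite A" "t > 0" "\<And>n. n \<in> A \<Longrightarrow> t \<le> norm (coord x n f)" for f A t
    using that(2,1,3,4)
  proof (induction A arbitrary: t rule: finite_psubset_induct)
    case (psubset A)
    show ?case
    proof (cases "A = {}")
      case True
      then show ?thesis using D E by (simp add: sign_sum_def qnorm_nonneg)
    next
      case False
      \<comment> \<open>Working at the minimum \<open>s\<close> instead of \<open>t\<close> puts an
        index attaining it into the lower part, so the upper part is a proper subset of
        \<open>A\<close>.\<close>
      define s where "s = (MIN n\<in>A. norm (coord x n f))"
      have s: "s \<in> (\<lambda>n. norm (coord x n f)) ` A" "\<And>n. n \<in> A \<Longrightarrow> s \<le> norm (coord x n f)"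
        using psubset(1) False unfolding s_def by (auto intro!: Min_in)
      have ts: "t \<le> s" using s(1) psubset.prems by auto
      then have s_pos: "s > 0" using psubset.prems(2) by linarith
      let ?P = "\<lambda>n. norm (coord x n f) \<le> D * s"
      have Ds: "s < D * s" using D s_pos by simp
      have low: "s * qnorm (sign_sum f {n\<in>A. ?P n}) \<le> E * qnorm f"
        using psubset.prems(1) psubset(1) s_pos s(2) by (intro layer_boundD[OF E(2)]) auto
      obtain m where "m \<in> A" "norm (coord x m f) = s" using s(1) by auto
      then have sub: "{n\<in>A. \<not> ?P n} \<subset> A" using Ds by force
      have "(D * s) * qnorm (sign_sum f {n\<in>A. \<not> ?P n}) \<le> (D * E) * qnorm f"
        using psubset.prems(1) Ds s_pos by (intro psubset.IH[OF sub]) auto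
      then have high: "s * qnorm (sign_sum f {n\<in>A. \<not> ?P n}) \<le> E * qnorm f"
        using D by (simp add: mult.assoc)
      have "t * qnorm (sign_sum f A) \<le> s * qnorm (sign_sum f A)"
        using ts by (intro mult_right_mono qnorm_nonneg)
      also have "\<dots> \<le>
          s * (?k * (qnorm (sign_sum f {n\<in>A. ?P n}) + qnorm (sign_sum f {n\<in>A. \<not> ?P n})))"
        using psubset(1) s_pos by (intro mult_left_mono qnorm_sign_sum_split) auto
      also have "\<dots> = ?k * (s * qnorm (sign_sum f {n\<in>A. ?P n}) + s * qnorm (sign_sum f {n\<in>A. \<not> ?P n}))"
        by (simp add: algebra_simps)
      also have "\<dots> \<le> ?k * (E * qnorm f + E * qnorm f)"
        using k low high by (intro mult_left_mono add_mono) auto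
      also have "\<dots> = (D * E) * qnorm f" by (simp add: D_def algebra_simps)
      finally show ?thesis .
    qed
  qed
  show ?thesis
  proof (rule that[of "D * E"])
    show "D * E > 0" using D E(1) by simp
  next
    fix f A and t :: real
    assume "A \<subseteq> {1..}" "finite A" "t \<ge> 0" "\<And>n. n \<in> A \<Longrightarrow> t \<le> norm (coord x n f)"
    then show "t * qnorm (sign_sum f A) \<le> (D * E) * qnorm f"
      using D E(1) by (cases "t = 0") (simp add: qnorm_nonneg, intro pos, auto)
  qed
qed

section \<open>Implications between the three properties\<close>

lemma truncation_quasi_greedy_if_at_1_1:
  assumes "bounded_oscillation_unconditional_at 1 1 x"
  shows "truncation_quasi_greedy x"
proof -
  obtain E where E: "E > 0"
    "\<And>f A t. A \<subseteq> {1..} \<Longrightarrow> finite A \<Longrightarrow> t \<ge> 0 \<Longrightarrow> (\<And>n. n \<in> A \<Longrightarrow> t \<le> norm (coord x n f)) \<Longrightarrow>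
       t * qnorm (sign_sum f A) \<le> E * qnorm f"
    using sign_sum_lower_bound[OF assms] by blast
  show ?thesis
    unfolding truncation_quasi_greedy_def sign_sum_def[symmetric]
  proof (intro exI[of _ E] allI impI, elim conjE)
    fix f A assume "greedy_set x f A" "A \<noteq> {}"
    then show "(MIN n\<in>A. norm (coord x n f)) * qnorm (sign_sum f A) \<le> E * qnorm f"
      by (intro E(2)) (auto simp: greedy_set_def)
  qed
qed

text \<open>Let \<open>t\<close> be the minimum modulus on \<open>A\<close>. Oscillation at most
  \<open>D\<close> gives moduli at most \<open>D * t\<close>, so for \<open>t > 0\<close> the
  projection is \<open>D * t\<close> times a combination of signed basis vectors with weights in
  [0,1]. \<open>sign_sum_uniform\<close> compares it with \<open>sign_sum f A\<close>, which
  \<open>sign_sum_lower_bound\<close> controls.\<close>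

lemma bounded_oscillation_unconditional_if_at_1_1:
  assumes "bounded_oscillation_unconditional_at 1 1 x"
  shows "bounded_oscillation_unconditional x"
proof -
  obtain E where E: "E > 0"
    "\<And>f A t. A \<subseteq> {1..} \<Longrightarrow> finite A \<Longrightarrow> t \<ge> 0 \<Longrightarrow> (\<And>n. n \<in> A \<Longrightarrow> t \<le> norm (coord x n f)) \<Longrightarrow>
       t * qnorm (sign_sum f A) \<le> E * qnorm f"
    using sign_sum_lower_bound[OF assms] by blast
  obtain K where K: "K > 0"
    "\<And>f A c. A \<subseteq> {1..} \<Longrightarrow> finite A \<Longrightarrow> (\<And>n. n \<in> A \<Longrightarrow> 0 \<le> c n \<and> c n \<le> 1) \<Longrightarrow>
       qnorm (\<Sum>n\<in>A. scale (of_real (c n) * sign (coord x n f)) (x n)) \<le> K * qnorm (sign_sum f A)"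
    using sign_sum_uniform[OF assms] by blast
  have bound: "qnorm (coord_proj x A f) \<le> (D * K * E) * qnorm f"
    if A: "A \<subseteq> {1..}" "finite A" "A \<noteq> {}" and osc: "osc x f A \<le> ereal D" and D: "1 \<le> D" for D f A
  proof -
    define t where "t = (MIN n\<in>A. norm (coord x n f))"
    have t: "t \<in> (\<lambda>n. norm (coord x n f)) ` A" "\<And>n. n \<in> A \<Longrightarrow> t \<le> norm (coord x n f)"
      using A unfolding t_def by (auto intro!: Min_in)
    then have t0: "t \<ge> 0" by auto
    have up: "norm (coord x n f) \<le> D * t" if "n \<in> A" for n
      using osc_le_iff[OF A(2,3) D, of f] osc t(1) that by auto
    show ?thesis
    proof (cases "t = 0")
      case True
      then have "coord_proj x A f = 0"
        unfolding coord_proj_def using up by (intro sum.neutral) auto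
      then show ?thesis using D K(1) E(1) by (simp add: qnorm_nonneg)
    next
      case False
      then have Dt: "D * t > 0" using t0 D by simp
      define c where "c n = norm (coord x n f) / (D * t)" for n
      have c: "0 \<le> c n \<and> c n \<le> 1" if "n \<in> A" for n
        using up[OF that] Dt unfolding c_def by (simp add: divide_le_eq_1)
      have "of_real (D * t) * (of_real (c n) * sign (coord x n f)) = coord x n f" for n
      proof -
        have "D * t * c n = norm (coord x n f)" using False D by (simp add: c_def)
        then show ?thesis by (metis mult.assoc of_real_mult sign_times_norm)
      qed
      then have "coord_proj x A f = scale (of_real (D * t))
          (\<Sum>n\<in>A. scale (of_real (c n) * sign (coord x n f)) (x n))"
        unfolding coord_proj_def scale_sum_right scale_scale by simp
      then have "qnorm (coord_proj x A f) =
          (D * t) * qnorm (\<Sum>n\<in>A. scale (of_real (c n) * sign (coord x n f)) (x n))"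
        using Dt by (simp only: qnorm_scale_real)
      also have "\<dots> \<le> (D * t) * (K * qnorm (sign_sum f A))"
        using A c Dt by (intro mult_left_mono K(2)) auto
      also have "\<dots> = (D * K) * (t * qnorm (sign_sum f A))" by simp
      also have "\<dots> \<le> (D * K) * (E * qnorm f)"
        using A t t0 D K(1) by (intro mult_left_mono E(2)) auto
      finally show ?thesis by (simp add: mult.assoc)
    qed
  qed
  have "bounded_oscillation_unconditional_at D d x" if "1 \<le> D" for d D
    unfolding bounded_oscillation_unconditional_at_def
    by (intro exI[of _ "D * K * E"] allI impI, elim conjE) (rule bound[OF _ _ _ _ that])
  then show ?thesis
    unfolding bounded_oscillation_unconditional_def by simp
qed

lemma at_1_1_if_truncation_quasi_greedy:
  assumes "truncation_quasi_greedy x"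
  shows "bounded_oscillation_unconditional_at 1 1 x"
proof -
  obtain C0 where C0: "\<forall>f A. greedy_set x f A \<and> A \<noteq> {} \<longrightarrow>
      (MIN n\<in>A. norm (coord x n f)) * qnorm (sign_sum f A) \<le> C0 * qnorm f"
    using assms unfolding truncation_quasi_greedy_def sign_sum_def ..
  \<comment> \<open>The constant will multiply an inequality when the two estimates are composed, so
    it is made nonnegative.\<close>
  define C where "C = \<bar>C0\<bar>"
  have C: "t * qnorm (sign_sum f A) \<le> C * qnorm f"
    if "greedy_set x f A" "A \<noteq> {}" "\<And>n. n \<in> A \<Longrightarrow> t \<le> norm (coord x n f)" for f A t
  proof -
    have "t \<le> (MIN n\<in>A. norm (coord x n f))"
      using that by (subst Min_ge_iff) (auto simp: greedy_set_def)
    then have "t * qnorm (sign_sum f A) \<le> (MIN n\<in>A. norm (coord x n f)) * qnorm (sign_sum f A)"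
      by (intro mult_right_mono qnorm_nonneg)
    also have "\<dots> \<le> C0 * qnorm f" using C0 that by simp
    also have "\<dots> \<le> C * qnorm f" unfolding C_def by (intro mult_right_mono qnorm_nonneg) simp
    finally show ?thesis .
  qed
  have bound: "qnorm (coord_proj x A f) \<le> (C * C) * qnorm f"
    if A: "A \<subseteq> {1..}" "finite A" "A \<noteq> {}" and osc: "osc x f A \<le> ereal 1" for f A
  proof -
    obtain m where m: "m \<in> A" using A by blast
    define t where "t = norm (coord x m f)"
    have osc': "\<forall>m\<in>A. \<forall>n\<in>A. norm (coord x n f) \<le> norm (coord x m f)"
      using osc_le_iff[OF A(2,3), of 1 f] osc by simp
    then have t: "norm (coord x n f) = t" if "n \<in> A" for n
      using m that unfolding t_def by (meson order_antisym)
    show ?thesis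
    \<comment> \<open>For \<open>t = 0\<close> the superlevel set \<open>G\<close> would be all of
      \<open>{1..}\<close>, hence infinite and not a greedy set.\<close>
    proof (cases "t = 0")
      case True
      then show ?thesis using t by (simp add: coord_proj_eq_scale_sign_sum C_def qnorm_nonneg)
    next
      case False
      then have t_pos: "t > 0" by (simp add: t_def)
      define G where "G = {n. n \<ge> 1 \<and> t \<le> norm (coord x n f)}"
      have G: "finite G" "G \<subseteq> {1..}" "A \<subseteq> G"
        using finite_coord_ge[OF t_pos] A(1) t by (auto simp: G_def)
      define h where "h = sign_sum f G"
      have h: "coord x n h = (if n \<in> G then sign (coord x n f) else 0)" if "n \<ge> 1" for n
        unfolding h_def sign_sum_def using G that by (subst coord_sum) auto
      have "greedy_set x f G" using G by (auto simp: greedy_set_def G_def)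
      then have 1: "t * qnorm h \<le> C * qnorm f"
        unfolding h_def using A(3) G(3) by (intro C) (auto simp: G_def)
      have hA: "coord x n h = sign (coord x n f)" if "n \<in> A" for n
        using h[of n] A(1) G(3) that by (auto simp: subset_iff)
      \<comment> \<open>Off \<open>G\<close> the coordinates of \<open>h\<close> vanish and on
        \<open>G\<close> they have modulus 1, so every subset of \<open>G\<close> is a greedy set of
        \<open>h\<close>.\<close>
      have "greedy_set x h A" using A G h hA by (auto simp: greedy_set_def)
      then have "1 * qnorm (sign_sum h A) \<le> C * qnorm h"
        using A hA by (intro C) auto
      moreover have "sign_sum h A = sign_sum f A"
        unfolding sign_sum_def using hA by (intro sum.cong) auto
      ultimately have 2: "qnorm (sign_sum f A) \<le> C * qnorm h" by simp
      have "qnorm (coord_proj x A f) = t * qnorm (sign_sum f A)"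
        using t t_pos by (simp add: coord_proj_eq_scale_sign_sum qnorm_scale)
      also have "\<dots> \<le> t * (C * qnorm h)" using 2 t_pos by (intro mult_left_mono) auto
      also have "\<dots> = C * (t * qnorm h)" by simp
      also have "\<dots> \<le> C * (C * qnorm f)" using 1 by (intro mult_left_mono) (auto simp: C_def)
      finally show ?thesis by simp
    qed
  qed
  show ?thesis
    unfolding bounded_oscillation_unconditional_at_def
    by (intro exI[of _ "C * C"] allI impI, elim conjE) (rule bound)
qed

theorem bounded_oscillation_unconditional_iff_at_1_1:
  "bounded_oscillation_unconditional x \<longleftrightarrow> bounded_oscillation_unconditional_at 1 1 x"
proof
  assume "bounded_oscillation_unconditional x"
  then show "bounded_oscillation_unconditional_at 1 1 x"
    unfolding bounded_oscillation_unconditional_def by simp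
qed (rule bounded_oscillation_unconditional_if_at_1_1)

theorem at_1_1_iff_truncation_quasi_greedy:
  "bounded_oscillation_unconditional_at 1 1 x \<longleftrightarrow> truncation_quasi_greedy x"
  by (rule iffI[OF truncation_quasi_greedy_if_at_1_1 at_1_1_if_truncation_quasi_greedy])

end

section \<open>Real and complex scalars\<close>

theorem theorem1p5:
  fixes scale\<^sub>R :: "real \<Rightarrow> 'a::ab_group_add \<Rightarrow> 'a" and qnorm\<^sub>R :: "'a \<Rightarrow> real" and x :: "nat \<Rightarrow> 'a"
    and scale\<^sub>C :: "complex \<Rightarrow> 'b::ab_group_add \<Rightarrow> 'b" and qnorm\<^sub>C :: "'b \<Rightarrow> real" and y :: "nat \<Rightarrow> 'b"
  shows
    "(quasi_banach_space scale\<^sub>R qnorm\<^sub>R \<and> quasi_normed_space.is_basis scale\<^sub>R qnorm\<^sub>R x \<longrightarrow>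
       (quasi_normed_space.bounded_oscillation_unconditional scale\<^sub>R qnorm\<^sub>R x \<longleftrightarrow>
        quasi_normed_space.bounded_oscillation_unconditional_at scale\<^sub>R qnorm\<^sub>R 1 1 x) \<and>
       (quasi_normed_space.bounded_oscillation_unconditional_at scale\<^sub>R qnorm\<^sub>R 1 1 x \<longleftrightarrow>
        quasi_normed_space.truncation_quasi_greedy scale\<^sub>R qnorm\<^sub>R x)) \<and>
     (quasi_banach_space scale\<^sub>C qnorm\<^sub>C \<and> quasi_normed_space.is_basis scale\<^sub>C qnorm\<^sub>C y \<longrightarrow>
       (quasi_normed_space.bounded_oscillation_unconditional scale\<^sub>C qnorm\<^sub>C y \<longleftrightarrow>
        quasi_normed_space.bounded_oscillation_unconditional_at scale\<^sub>C qnorm\<^sub>C 1 1 y) \<and>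
       (quasi_normed_space.bounded_oscillation_unconditional_at scale\<^sub>C qnorm\<^sub>C 1 1 y \<longleftrightarrow>
        quasi_normed_space.truncation_quasi_greedy scale\<^sub>C qnorm\<^sub>C y))"
proof (intro conjI[OF impI impI]; elim conjE)
  assume "quasi_banach_space scale\<^sub>R qnorm\<^sub>R" "quasi_normed_space.is_basis scale\<^sub>R qnorm\<^sub>R x"
  then interpret quasi_normed_basis scale\<^sub>R qnorm\<^sub>R x
    by (intro quasi_normed_basis.intro quasi_normed_basis_axioms.intro quasi_banach_space.axioms)
  show "(bounded_oscillation_unconditional x \<longleftrightarrow> bounded_oscillation_unconditional_at 1 1 x) \<and>
      (bounded_oscillation_unconditional_at 1 1 x \<longleftrightarrow> truncation_quasi_greedy x)"
    by (intro conjI bounded_oscillation_unconditional_iff_at_1_1 at_1_1_iff_truncation_quasi_greedy)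
next
  assume "quasi_banach_space scale\<^sub>C qnorm\<^sub>C" "quasi_normed_space.is_basis scale\<^sub>C qnorm\<^sub>C y"
  then interpret quasi_normed_basis scale\<^sub>C qnorm\<^sub>C y
    by (intro quasi_normed_basis.intro quasi_normed_basis_axioms.intro quasi_banach_space.axioms)
  show "(bounded_oscillation_unconditional y \<longleftrightarrow> bounded_oscillation_unconditional_at 1 1 y) \<and>
      (bounded_oscillation_unconditional_at 1 1 y \<longleftrightarrow> truncation_quasi_greedy y)"
    by (intro conjI bounded_oscillation_unconditional_iff_at_1_1 at_1_1_iff_truncation_quasi_greedy)
qed

end
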